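(* Let $S=\langle n_0,\ldots,n_p\rangle$ be a numerical semigroup on a compound sequence (NSCS), with associated integers $a_1,\ldots,a_p,b_1,\ldots,b_p$. Then $\{a_1n_1,a_2n_2,\ldots,a_pn_p\}$ is the set of Betti elements of $S$.
   Context: Let $\mathbb{N}$ be the positive integers and $\mathbb{N}_0$ the nonnegative integers. A compound sequence is a sequence $\{n_0,\ldots,n_p\}$ with $n_i=b_1b_2\cdots b_i\,a_{i+1}a_{i+2}\cdots a_p$ for $i\in[0,p]$, where $p,a_1,\ldots,a_p,b_1,\ldots,b_p\in\mathbb{N}$ satisfy $2\le a_i<b_i$ for all $i\in[1,p]$ and $\gcd(a_i,b_j)=1$ for all $i,j\in[1,p]$ with $i\ge j$. An NSCS is a numerical semigroup $S=\langle n_0,\ldots,n_p\rangle$ whose minimal generators form a compound sequence. The factorization homomorphism is $\phi:\mathbb{N}_0^{p+1}\to S$, $\phi(x_0,\ldots,x_p)=x_0n_0+\cdots+x_pn_p$; the elements of $\phi^{-1}(n)$ are the factorizations of $n$. An element $n\in S$ with $n>1$ is a Betti element if there is a partition $\phi^{-1}(n)=X\cup Y$ into two nonempty disjoint sets such that $\sum_{i=0}^px_iy_i=0$ for each $x\in X$, $y\in Y$. *)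

theory Defs
  imports Complex_Main "HOL-Library.FuncSet"
begin

definition compound_data :: "nat \<Rightarrow> (nat \<Rightarrow> nat) \<Rightarrow> (nat \<Rightarrow> nat) \<Rightarrow> bool" where
  "compound_data p a b \<longleftrightarrow>
     1 \<le> p \<and>
     (\<forall>i\<in>{1..p}. 2 \<le> a i \<and> a i < b i) \<and>
     (\<forall>i\<in>{1..p}. \<forall>j\<in>{1..p}. j \<le> i \<longrightarrow> gcd (a i) (b j) = 1)"

definition compound_seq :: "nat \<Rightarrow> (nat \<Rightarrow> nat) \<Rightarrow> (nat \<Rightarrow> nat) \<Rightarrow> nat \<Rightarrow> nat" where
  "compound_seq p a b i = (\<Prod>j\<in>{1..i}. b j) * (\<Prod>j\<in>{i+1..p}. a j)"

definition submonoid :: "nat set \<Rightarrow> bool" where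
  "submonoid T \<longleftrightarrow> 0 \<in> T \<and> (\<forall>x\<in>T. \<forall>y\<in>T. x + y \<in> T)"

definition numerical_semigroup :: "nat set \<Rightarrow> bool" where
  "numerical_semigroup S \<longleftrightarrow> submonoid S \<and> finite (- S)"

definition minimal_generating_set :: "nat set \<Rightarrow> nat set \<Rightarrow> bool" where
  "minimal_generating_set S A \<longleftrightarrow>
     submonoid hull A = S \<and> (\<forall>B. B \<subset> A \<longrightarrow> submonoid hull B \<noteq> S)"

definition nscs :: "nat set \<Rightarrow> nat \<Rightarrow> (nat \<Rightarrow> nat) \<Rightarrow> (nat \<Rightarrow> nat) \<Rightarrow> bool" where
  "nscs S p a b \<longleftrightarrow>
     numerical_semigroup S \<and> compound_data p a b \<and>
     minimal_generating_set S (compound_seq p a b ` {0..p})"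

text \<open>Tuples \<open>(x\<^sub>0, \<dots>, x\<^sub>p)\<close> of nonnegative integers are extensional functions on \<open>{0..p}\<close>;
  \<open>g 0, \<dots>, g p\<close> are the generators.\<close>

definition fact_hom :: "nat \<Rightarrow> (nat \<Rightarrow> nat) \<Rightarrow> (nat \<Rightarrow> nat) \<Rightarrow> nat" where
  "fact_hom p g x = (\<Sum>i\<in>{0..p}. x i * g i)"

definition factorizations :: "nat \<Rightarrow> (nat \<Rightarrow> nat) \<Rightarrow> nat \<Rightarrow> (nat \<Rightarrow> nat) set" where
  "factorizations p g n = {x \<in> {0..p} \<rightarrow>\<^sub>E UNIV. fact_hom p g x = n}"

definition betti_element :: "nat set \<Rightarrow> nat \<Rightarrow> (nat \<Rightarrow> nat) \<Rightarrow> nat \<Rightarrow> bool" where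
  "betti_element S p g n \<longleftrightarrow>
     n \<in> S \<and> 1 < n \<and>
     (\<exists>X Y. factorizations p g n = X \<union> Y \<and> X \<inter> Y = {} \<and> X \<noteq> {} \<and> Y \<noteq> {} \<and>
       (\<forall>x\<in>X. \<forall>y\<in>Y. (\<Sum>i\<in>{0..p}. x i * y i) = 0))"

end

theory Submission
  imports Defs
begin

text \<open>
  Write \<open>A\<^sub>i = a\<^sub>i \<cdots> a\<^sub>p\<close> and \<open>B\<^sub>i = b\<^sub>1 \<cdots> b\<^sub>i\<close>. These are coprime, \<open>A\<^sub>i\<close> divides \<open>n\<^sub>j\<close> for
  \<open>j < i\<close>, \<open>B\<^sub>i\<close> divides \<open>n\<^sub>j\<close> for \<open>j \<ge> i\<close>, and \<open>a\<^sub>i n\<^sub>i = A\<^sub>i B\<^sub>i = b\<^sub>i n\<^sub>i\<^sub>-\<^sub>1\<close>. So a factorization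
  of \<open>a\<^sub>i n\<^sub>i\<close> is supported either on the indices below \<open>i\<close> or on those from \<open>i\<close> on, and both
  cases occur: \<open>a\<^sub>i n\<^sub>i\<close> is a Betti element.

  Conversely, trading \<open>a\<^sub>i\<close> copies of \<open>n\<^sub>i\<close> for \<open>b\<^sub>i\<close> copies of \<open>n\<^sub>i\<^sub>-\<^sub>1\<close> lengthens a factorization.
  If \<open>n\<close> is none of the \<open>a\<^sub>i n\<^sub>i\<close>, such a trade leaves some generator in place and hence stays
  inside each block of the partition. A longest factorization in either block therefore has
  \<open>x\<^sub>i < a\<^sub>i\<close> for all \<open>i \<ge> 1\<close>, but only one factorization of \<open>n\<close> has this property.
\<close>

section \<open>Arithmetic of compound sequences\<close>

lemma prod_dvd_compound_seq_below:
  assumes "j < i"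
  shows "(\<Prod>k\<in>{i..p}. a k) dvd compound_seq p a b j"
proof -
  have "(\<Prod>k\<in>{i..p}. a k) dvd (\<Prod>k\<in>{j+1..p}. a k)"
    using assms by (intro prod_dvd_prod_subset) auto
  then show ?thesis
    unfolding compound_seq_def by (rule dvd_mult)
qed

lemma prod_dvd_compound_seq_above:
  assumes "i \<le> j"
  shows "(\<Prod>k\<in>{1..i}. b k) dvd compound_seq p a b j"
proof -
  have "(\<Prod>k\<in>{1..i}. b k) dvd (\<Prod>k\<in>{1..j}. b k)"
    using assms by (intro prod_dvd_prod_subset) auto
  then show ?thesis
    unfolding compound_seq_def by (rule dvd_mult2)
qed

lemma mult_compound_seq_eq:
  assumes "i \<le> p"
  shows "a i * compound_seq p a b i = (\<Prod>k\<in>{i..p}. a k) * (\<Prod>k\<in>{1..i}. b k)"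
  using prod.atLeast_Suc_atMost[OF assms, of a]
  by (simp add: compound_seq_def mult_ac)

lemma compound_seq_exchange:
  assumes "1 \<le> i" "i \<le> p"
  shows "b i * compound_seq p a b (i - 1) = a i * compound_seq p a b i"
proof -
  have "(\<Prod>k\<in>{1..i}. b k) = (\<Prod>k\<in>{1..i - 1}. b k) * b i"
    using assms by (cases i) simp_all
  then show ?thesis
    using assms by (simp add: mult_compound_seq_eq) (simp add: compound_seq_def mult_ac)
qed

lemma compound_data_bounds:
  assumes "compound_data p a b" "1 \<le> i" "i \<le> p"
  shows "2 \<le> a i" "a i < b i"
  using assms by (auto simp: compound_data_def)

lemma compound_data_coprime:
  assumes "compound_data p a b" "1 \<le> j" "j \<le> i" "i \<le> p"
  shows "coprime (a i) (b j)"
  using assms by (auto simp: compound_data_def coprime_iff_gcd_eq_1)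

lemma compound_seq_pos:
  assumes "compound_data p a b" "i \<le> p"
  shows "0 < compound_seq p a b i"
proof -
  have "0 < a j" "0 < b j" if "1 \<le> j" "j \<le> p" for j
    using compound_data_bounds[OF assms(1) that] by linarith+
  then show ?thesis
    using assms(2) by (auto simp: compound_seq_def intro!: prod_pos)
qed

lemma coprime_prods_compound_data:
  assumes "compound_data p a b" "1 \<le> i"
  shows "coprime (\<Prod>k\<in>{i..p}. a k) (\<Prod>k\<in>{1..i}. b k)"
  using assms by (intro prod_coprime_left prod_coprime_right)
    (auto intro: compound_data_coprime)

text \<open>\<open>B\<close> divides both \<open>t\<close> and \<open>s + t\<close>, hence
  \<open>s\<close>, so coprimality makes \<open>A * B\<close> divide \<open>s\<close>. As
  \<open>s\<close> is at most \<open>A * B\<close>, it is either 0 or the whole sum.\<close>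

lemma coprime_summands_of_product:
  fixes A B s t :: nat
  assumes "coprime A B" "A dvd s" "B dvd t" "s + t = A * B"
  shows "s = 0 \<or> t = 0"
proof -
  have "B dvd s"
    using assms(3,4) by (metis dvd_add_left_iff dvd_triv_right)
  then have "A * B dvd s"
    using assms(1,2) by (simp add: divides_mult)
  then show ?thesis
    using assms(4) by (metis add_cancel_right_right dvd_imp_le le_add1 le_antisym neq0_conv)
qed

section \<open>Values and lengths of factorizations\<close>

lemma fact_hom_split:
  assumes "i \<le> p"
  shows "fact_hom p g x = (\<Sum>j<i. x j * g j) + (\<Sum>j\<in>{i..p}. x j * g j)"
proof -
  have "{0..p} = {..<i} \<union> {i..p}"
    using assms by auto
  then show ?thesis
    unfolding fact_hom_def by (simp add: sum.union_disjoint ivl_disj_int)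
qed

text \<open>The old term is added on the left instead of subtracted on the right, because
  subtraction of naturals truncates.\<close>

lemma fact_hom_fun_upd:
  assumes "k \<le> p"
  shows "fact_hom p g (x(k := v)) + x k * g k = fact_hom p g x + v * g k"
proof -
  have "(\<Sum>i\<in>{0..p} - {k}. (x(k := v)) i * g i) = (\<Sum>i\<in>{0..p} - {k}. x i * g i)"
    by (intro sum.cong) auto
  then show ?thesis
    using assms by (simp add: fact_hom_def sum.remove[of "{0..p}" k])
qed

lemma sum_fun_upd:
  fixes x :: "nat \<Rightarrow> nat"
  assumes "k \<le> p"
  shows "(\<Sum>i\<in>{0..p}. (x(k := v)) i) + x k = (\<Sum>i\<in>{0..p}. x i) + v"
  using fact_hom_fun_upd[OF assms, of "\<lambda>_. 1"] by (simp add: fact_hom_def)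

lemma factorization_of_exchange_value:
  assumes "compound_data p a b" "1 \<le> i" "i \<le> p"
    and "fact_hom p (compound_seq p a b) x = a i * compound_seq p a b i"
  shows "(\<forall>j<i. x j = 0) \<or> (\<forall>j\<in>{i..p}. x j = 0)"
proof -
  let ?g = "compound_seq p a b"
  have "(\<Sum>j<i. x j * ?g j) = 0 \<or> (\<Sum>j\<in>{i..p}. x j * ?g j) = 0"
  proof (rule coprime_summands_of_product)
    show "coprime (\<Prod>k\<in>{i..p}. a k) (\<Prod>k\<in>{1..i}. b k)"
      using assms by (intro coprime_prods_compound_data)
    show "(\<Prod>k\<in>{i..p}. a k) dvd (\<Sum>j<i. x j * ?g j)"
      by (intro dvd_sum dvd_mult prod_dvd_compound_seq_below) simp
    show "(\<Prod>k\<in>{1..i}. b k) dvd (\<Sum>j\<in>{i..p}. x j * ?g j)"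
      by (intro dvd_sum dvd_mult prod_dvd_compound_seq_above) simp
    show "(\<Sum>j<i. x j * ?g j) + (\<Sum>j\<in>{i..p}. x j * ?g j)
        = (\<Prod>k\<in>{i..p}. a k) * (\<Prod>k\<in>{1..i}. b k)"
      using assms(3,4) fact_hom_split[of i p ?g x] mult_compound_seq_eq[of i p a b] by simp
  qed
  \<comment> \<open>Since the generators are positive, a vanishing partial sum has only zero
    coordinates.\<close>
  moreover have "?g j \<noteq> 0" if "j \<le> p" for j
    using compound_seq_pos[OF assms(1) that] by simp
  ultimately show ?thesis
    using assms(3) by auto
qed

section \<open>Uniqueness of factorizations with x_i < a_i for all i >= 1\<close>

lemma normal_factorization_unique:
  assumes cd: "compound_data p a b"
    and x: "x \<in> factorizations p (compound_seq p a b) n" "\<And>i. 1 \<le> i \<Longrightarrow> i \<le> p \<Longrightarrow> x i < a i"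
    and y: "y \<in> factorizations p (compound_seq p a b) n" "\<And>i. 1 \<le> i \<Longrightarrow> i \<le> p \<Longrightarrow> y i < a i"
  shows "x = y"
proof (rule ccontr)
  assume "x \<noteq> y"
  let ?g = "compound_seq p a b"
  let ?D = "{i \<in> {0..p}. x i \<noteq> y i}"
  have "?D \<noteq> {}"
  proof
    assume "?D = {}"
    then have "x = y"
      using x(1) y(1) by (intro PiE_ext[of x "{0..p}" "\<lambda>_. UNIV"]) (auto simp: factorizations_def)
    with \<open>x \<noteq> y\<close> show False ..
  qed
  \<comment> \<open>Above the largest index of disagreement the terms cancel, so index
    \<open>k\<close> carries the top remaining term.\<close>
  moreover define k where "k = Max ?D"
  ultimately have "k \<in> ?D"
    unfolding k_def by (intro Max_in) simp_all
  then have k: "k \<le> p" "x k \<noteq> y k"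
    by auto
  have above: "x j = y j" if "k < j" "j \<le> p" for j
  proof (rule ccontr)
    assume "x j \<noteq> y j"
    then have "j \<le> k"
      using that(2) unfolding k_def by (intro Max_ge) auto
    with that(1) show False by simp
  qed
  have tail: "(\<Sum>j\<in>{k..p}. z j * ?g j) = z k * ?g k + (\<Sum>j\<in>{Suc k..p}. z j * ?g j)" for z
    using k(1) by (rule sum.atLeast_Suc_atMost)
  have "(\<Sum>j\<in>{Suc k..p}. x j * ?g j) = (\<Sum>j\<in>{Suc k..p}. y j * ?g j)"
    by (intro sum.cong) (auto simp: above)
  moreover have "fact_hom p ?g x = fact_hom p ?g y"
    using x(1) y(1) by (simp add: factorizations_def)
  ultimately have eq: "(\<Sum>j<k. x j * ?g j) + x k * ?g k = (\<Sum>j<k. y j * ?g j) + y k * ?g k"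
    by (simp add: fact_hom_split[OF k(1)] tail)
  show False
  proof (cases "k = 0")
    \<comment> \<open>Index 0 carries no bound, but there are no lower terms either: cancelling the
      positive n_0 gives x_0 = y_0.\<close>
    case True
    then show False
      using eq k compound_seq_pos[OF cd k(1)] by simp
  next
    case False
    then have k1: "1 \<le> k" by simp
    let ?A = "int (\<Prod>j\<in>{k..p}. a j)" and ?A' = "int (\<Prod>j\<in>{Suc k..p}. a j)"
      and ?B = "int (\<Prod>j\<in>{1..k}. b j)"
    \<comment> \<open>All generators below \<open>k\<close> vanish modulo \<open>?A\<close>.
      Integers allow the signed difference x_k - y_k.\<close>
    have dvd: "?A dvd int (\<Sum>j<k. z j * ?g j)" for z
      unfolding int_dvd_int_iff
      by (intro dvd_sum dvd_mult prod_dvd_compound_seq_below) simp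
    have "(int (x k) - int (y k)) * int (?g k)
        = int (\<Sum>j<k. y j * ?g j) - int (\<Sum>j<k. x j * ?g j)"
      using arg_cong[OF eq, of int] unfolding of_nat_add of_nat_mult left_diff_distrib
      by linarith
    then have "?A dvd (int (x k) - int (y k)) * int (?g k)"
      using dvd by (metis dvd_diff)
    moreover have "?A = int (a k) * ?A'"
      using prod.atLeast_Suc_atMost[OF k(1), of a] by simp
    moreover have "int (?g k) = ?B * ?A'"
      by (simp add: compound_seq_def)
    \<comment> \<open>Cancelling \<open>?A'\<close> leaves a_k dividing (x_k - y_k) times
      \<open>?B\<close>. The factors of \<open>?B\<close> are the b_j with j <= k, all coprime to
      a_k.\<close>
    ultimately have "int (a k) * ?A' dvd ((int (x k) - int (y k)) * ?B) * ?A'"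
      by (simp only: mult.assoc)
    moreover have "?A' \<noteq> 0"
      using compound_seq_pos[OF cd k(1)] by (auto simp: compound_seq_def)
    ultimately have "int (a k) dvd (int (x k) - int (y k)) * ?B"
      by (simp only: dvd_mult_cancel_right) simp
    moreover have "coprime (a k) (\<Prod>j\<in>{1..k}. b j)"
      using cd k(1) by (intro prod_coprime_right) (auto intro: compound_data_coprime)
    ultimately have "int (a k) dvd int (x k) - int (y k)"
      by (metis coprime_dvd_mult_left_iff coprime_int_iff)
    \<comment> \<open>Both coordinates are residues below a_k, so congruence modulo a_k is
      equality.\<close>
    then have "int (x k) mod int (a k) = int (y k) mod int (a k)"
      by (simp add: mod_eq_dvd_iff)
    then show False
      using k x(2)[OF k1 k(1)] y(2)[OF k1 k(1)] by simp
  qed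
qed

section \<open>Exchanges and longest factorizations\<close>

lemma exchange_step:
  assumes cd: "compound_data p a b"
    and x: "x \<in> factorizations p (compound_seq p a b) n"
    and i: "1 \<le> i" "i \<le> p" "a i \<le> x i"
    and n: "n \<noteq> a i * compound_seq p a b i"
  obtains y where "y \<in> factorizations p (compound_seq p a b) n"
    and "(\<Sum>j\<in>{0..p}. x j) < (\<Sum>j\<in>{0..p}. y j)"
    and "(\<Sum>j\<in>{0..p}. x j * y j) \<noteq> 0"
proof
  let ?g = "compound_seq p a b"
  \<comment> \<open>\<open>x'\<close> is the part that the trade leaves in place; it lies pointwise
    below both \<open>x\<close> and \<open>y\<close>.\<close>
  define x' where "x' = x(i := x i - a i)"
  define y where "y = x'(i - 1 := x' (i - 1) + b i)"
  have le: "i - 1 \<le> p" using i by simp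
  have ai: "x i - a i + a i = x i" using i by simp
  have phi_x: "fact_hom p ?g x = n"
    using x by (simp add: factorizations_def)
  have "fact_hom p ?g x' + x i * ?g i = n + (x i - a i) * ?g i"
    unfolding x'_def using fact_hom_fun_upd[OF i(2), of ?g x] phi_x by simp
  moreover have "x i * ?g i = (x i - a i) * ?g i + a i * ?g i"
    using ai by (metis add_mult_distrib)
  ultimately have phi_x': "fact_hom p ?g x' + a i * ?g i = n"
    by simp
  have "fact_hom p ?g y = fact_hom p ?g x' + b i * ?g (i - 1)"
    using fact_hom_fun_upd[OF le, of ?g x' "x' (i - 1) + b i"]
    by (simp add: y_def add_mult_distrib)
  then have "fact_hom p ?g y = n"
    using phi_x' compound_seq_exchange[OF i(1,2)] by simp
  moreover have "y \<in> {0..p} \<rightarrow>\<^sub>E UNIV"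
    using x i le by (auto simp: y_def x'_def factorizations_def PiE_iff extensional_def)
  ultimately show "y \<in> factorizations p ?g n"
    by (simp add: factorizations_def)
  have "(\<Sum>j\<in>{0..p}. x' j) + a i = (\<Sum>j\<in>{0..p}. x j)"
    using sum_fun_upd[OF i(2), of x "x i - a i"] i(3) unfolding x'_def by linarith
  moreover have "(\<Sum>j\<in>{0..p}. y j) = (\<Sum>j\<in>{0..p}. x' j) + b i"
    using sum_fun_upd[OF le, of x' "x' (i - 1) + b i"] unfolding y_def by linarith
  ultimately show "(\<Sum>j\<in>{0..p}. x j) < (\<Sum>j\<in>{0..p}. y j)"
    using compound_data_bounds[OF cd i(1,2)] by linarith
  \<comment> \<open>If \<open>x'\<close> had value 0, then n would be a_i n_i. So \<open>x'\<close>
    has a nonzero coordinate, which \<open>x\<close> and \<open>y\<close> share.\<close>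
  have "fact_hom p ?g x' \<noteq> 0"
    using phi_x' n by auto
  then obtain j where j: "j \<le> p" "x' j \<noteq> 0"
    by (auto simp: fact_hom_def)
  have "x j \<noteq> 0"
    using j(2) by (auto simp: x'_def split: if_splits)
  moreover have "y j \<noteq> 0"
    using j(2) by (auto simp: y_def)
  ultimately show "(\<Sum>j\<in>{0..p}. x j * y j) \<noteq> 0"
    using j(1) by auto
qed

text \<open>Every generator is at least 1. The bound ensures that a nonempty block has a longest
  member.\<close>

lemma factorization_length_le:
  assumes "compound_data p a b" "x \<in> factorizations p (compound_seq p a b) n"
  shows "(\<Sum>j\<in>{0..p}. x j) \<le> n"
proof -
  have "(\<Sum>j\<in>{0..p}. x j) \<le> (\<Sum>j\<in>{0..p}. x j * compound_seq p a b j)"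
  proof (rule sum_mono)
    fix j assume "j \<in> {0..p}"
    then have "1 \<le> compound_seq p a b j"
      using compound_seq_pos[OF assms(1), of j] by simp
    then show "x j \<le> x j * compound_seq p a b j"
      by simp
  qed
  then show ?thesis
    using assms(2) by (simp add: factorizations_def fact_hom_def)
qed

lemma normal_factorization_in_block:
  assumes cd: "compound_data p a b"
    and n: "n \<notin> (\<lambda>i. a i * compound_seq p a b i) ` {1..p}"
    and XY: "factorizations p (compound_seq p a b) n = X \<union> Y" "X \<noteq> {}"
    and orth: "\<forall>x\<in>X. \<forall>y\<in>Y. (\<Sum>i\<in>{0..p}. x i * y i) = 0"
  obtains x where "x \<in> X" "\<And>i. 1 \<le> i \<Longrightarrow> i \<le> p \<Longrightarrow> x i < a i"
proof -
  let ?len = "\<lambda>x. \<Sum>j\<in>{0..p}. x j"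
  obtain x0 where "x0 \<in> X"
    using XY(2) by auto
  moreover have "\<forall>x. x \<in> X \<longrightarrow> ?len x < Suc n"
    using factorization_length_le[OF cd] XY(1) by (auto simp: less_Suc_eq_le)
  ultimately obtain x where x: "x \<in> X" "\<And>y. y \<in> X \<Longrightarrow> ?len y \<le> ?len x"
    using ex_has_greatest_nat[of "\<lambda>x. x \<in> X" x0 ?len "Suc n"] by (metis less_imp_le)
  have "x i < a i" if i: "1 \<le> i" "i \<le> p" for i
  proof (rule ccontr)
    assume "\<not> x i < a i"
    then have "a i \<le> x i" by simp
    moreover have "n \<noteq> a i * compound_seq p a b i"
      using n i by auto
    moreover have "x \<in> factorizations p (compound_seq p a b) n"
      using x(1) XY(1) by blast
    ultimately obtain y where y: "y \<in> factorizations p (compound_seq p a b) n"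
      "?len x < ?len y" "(\<Sum>j\<in>{0..p}. x j * y j) \<noteq> 0"
      using exchange_step[OF cd _ i] by blast
    \<comment> \<open>Sharing a generator with \<open>x\<close> keeps \<open>y\<close> out of
      \<open>Y\<close>, so \<open>y\<close> would be a longer member of \<open>X\<close>.\<close>
    have "y \<notin> Y"
      using orth x(1) y(3) by metis
    then have "y \<in> X"
      using XY(1) y(1) by blast
    then show False
      using x(2) y(2) by (meson not_le)
  qed
  then show thesis
    using that x(1) by blast
qed

lemma betti_element_imp_exchange_value:
  assumes cd: "compound_data p a b"
    and "betti_element S p (compound_seq p a b) n"
  shows "n \<in> (\<lambda>i. a i * compound_seq p a b i) ` {1..p}"
proof (rule ccontr)
  let ?F = "factorizations p (compound_seq p a b) n"
  assume n: "n \<notin> (\<lambda>i. a i * compound_seq p a b i) ` {1..p}"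
  obtain X Y where XY: "?F = X \<union> Y" "X \<inter> Y = {}" "X \<noteq> {}" "Y \<noteq> {}"
    and orth: "\<forall>x\<in>X. \<forall>y\<in>Y. (\<Sum>i\<in>{0..p}. x i * y i) = 0"
    using assms(2) unfolding betti_element_def by blast
  have YX: "?F = Y \<union> X"
    using XY(1) by (simp add: Un_commute)
  have orth': "\<forall>y\<in>Y. \<forall>x\<in>X. (\<Sum>i\<in>{0..p}. y i * x i) = 0"
    by (subst mult.commute) (use orth in blast)
  obtain x where x: "x \<in> X" "\<And>i. 1 \<le> i \<Longrightarrow> i \<le> p \<Longrightarrow> x i < a i"
    using normal_factorization_in_block[OF cd n XY(1,3) orth] by blast
  obtain y where y: "y \<in> Y" "\<And>i. 1 \<le> i \<Longrightarrow> i \<le> p \<Longrightarrow> y i < a i"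
    using normal_factorization_in_block[OF cd n YX XY(4) orth'] by blast
  have "x \<in> ?F" "y \<in> ?F"
    using x(1) y(1) XY(1) by auto
  then have "x = y"
    using normal_factorization_unique[OF cd _ x(2) _ y(2)] by blast
  then show False
    using x(1) y(1) XY(2) by blast
qed

section \<open>The values a_i n_i are Betti elements\<close>

lemma single_generator_factorization:
  assumes "k \<le> p"
  shows "(\<lambda>j\<in>{0..p}. if j = k then c else 0) \<in> factorizations p g (c * g k)"
proof -
  have "fact_hom p g (\<lambda>j\<in>{0..p}. if j = k then c else 0)
      = (\<Sum>j\<in>{0..p}. if j = k then c * g j else 0)"
    unfolding fact_hom_def by (intro sum.cong) auto
  also have "\<dots> = c * g k"
    using assms by simp
  finally show ?thesis
    by (simp add: factorizations_def)
qed

lemma submonoid_mult_closed: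
  assumes "submonoid T" "x \<in> T"
  shows "m * x \<in> T"
  using assms by (induction m) (auto simp: submonoid_def)

lemma exchange_value_betti_element:
  assumes cd: "compound_data p a b"
    and S: "submonoid S" "compound_seq p a b i \<in> S"
    and i: "1 \<le> i" "i \<le> p"
  shows "betti_element S p (compound_seq p a b) (a i * compound_seq p a b i)"
proof -
  let ?g = "compound_seq p a b"
  let ?n = "a i * ?g i"
  let ?F = "factorizations p ?g ?n"
  define X where "X = {x \<in> ?F. \<forall>j<i. x j = 0}"
  define Y where "Y = {x \<in> ?F. \<forall>j\<in>{i..p}. x j = 0}"
  have "2 * 1 \<le> ?n"
    using compound_data_bounds(1)[OF cd i] compound_seq_pos[OF cd i(2)]
    by (intro mult_le_mono) auto
  then have n: "1 < ?n" by simp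
  have "(\<forall>j<i. x j = 0) \<or> (\<forall>j\<in>{i..p}. x j = 0)" if "x \<in> ?F" for x
    using factorization_of_exchange_value[OF cd i] that by (simp add: factorizations_def)
  then have "?F = X \<union> Y"
    unfolding X_def Y_def by blast
  moreover have "X \<inter> Y = {}"
  proof (rule ccontr)
    assume "X \<inter> Y \<noteq> {}"
    then obtain x where x: "x \<in> ?F" "\<forall>j<i. x j = 0" "\<forall>j\<in>{i..p}. x j = 0"
      by (auto simp: X_def Y_def)
    then have "fact_hom p ?g x = 0"
      by (simp add: fact_hom_split[OF i(2)])
    then show False
      using x(1) n by (auto simp: factorizations_def)
  qed
  \<comment> \<open>The two sides of the exchange identity a_i n_i = b_i n_(i-1) provide one member
    for each block.\<close>
  moreover have "(\<lambda>j\<in>{0..p}. if j = i then a i else 0) \<in> X"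
    using single_generator_factorization[OF i(2), of "a i" ?g] i by (auto simp: X_def)
  moreover have "(\<lambda>j\<in>{0..p}. if j = i - 1 then b i else 0) \<in> Y"
    using single_generator_factorization[of "i - 1" p "b i" ?g] i
      compound_seq_exchange[OF i, of b a]
    by (auto simp: Y_def)
  moreover have "(\<Sum>j\<in>{0..p}. x j * y j) = 0" if "x \<in> X" "y \<in> Y" for x y
  proof (rule sum.neutral, rule ballI)
    fix j assume "j \<in> {0..p}"
    then show "x j * y j = 0"
      using that by (cases "j < i") (auto simp: X_def Y_def)
  qed
  moreover have "?n \<in> S"
    using S by (rule submonoid_mult_closed)
  ultimately show ?thesis
    unfolding betti_element_def using n by (intro conjI exI[of _ X] exI[of _ Y]) auto
qed

theorem corollary10:
  fixes S :: "nat set" and p :: nat and a b :: "nat \<Rightarrow> nat"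
  assumes "nscs S p a b"
  shows "{n. betti_element S p (compound_seq p a b) n} =
         (\<lambda>i. a i * compound_seq p a b i) ` {1..p}"
proof -
  have cd: "compound_data p a b" and S: "submonoid S"
    and hull: "submonoid hull (compound_seq p a b ` {0..p}) = S"
    using assms by (auto simp: nscs_def numerical_semigroup_def minimal_generating_set_def)
  have "compound_seq p a b i \<in> S" if "i \<le> p" for i
    using that hull_subset[of "compound_seq p a b ` {0..p}" submonoid] hull by auto
  then show ?thesis
    using betti_element_imp_exchange_value[OF cd] exchange_value_betti_element[OF cd S]
    by auto
qed

end
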